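(* Let $(a_1,\dots,a_{60})$ be the vector \[ \begin{split} (&1,0,-7\beta^{2},0,-4\beta^{4},0,-\beta^{6},0,7\beta^{8},0,-\beta^{10},0,\beta^{12},0,-2\beta^{14},0,\beta^{16},0,-\beta^{18},0,7\beta^{20},0,-\beta^{22},0,\\ &-4\beta^{24},0,-7\beta^{26},0,\beta^{28},0,-\beta^{30},0,7\beta^{32},0,4\beta^{34},0,\beta^{36},0,-7\beta^{38},0,\beta^{40},0,-\beta^{42},0,\\ &2\beta^{44},0,-\beta^{46},0,\beta^{48},0,-7\beta^{50},0,\beta^{52},0,4\beta^{54},0,7\beta^{56},0,-\beta^{58},0). \end{split} \] Then \[ \sum_{k=0}^\infty\frac{1}{\alpha^{60k}}\sum_{j=1}^{60}\frac{a_j}{60k+j}=0. \]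
   Context: $\alpha=(1+\sqrt5)/2$ is the golden ratio and $\beta=-1/\alpha=(1-\sqrt5)/2$. *)

theory Defs
  imports Complex_Main
begin

definition golden_alpha :: real  ("\<alpha>")
  where "\<alpha> = (1 + sqrt 5) / 2"

definition golden_beta :: real  ("\<beta>")
  where "\<beta> = (1 - sqrt 5) / 2"

lemma golden_beta_eq: "\<beta> = - 1 / \<alpha>"
proof -
  have "1 + sqrt 5 > 0" by (simp add: add_pos_pos)
  then show ?thesis
    by (simp add: golden_alpha_def golden_beta_def field_simps)
qed

definition a_vec :: "real list" where
  "a_vec =
    [1, 0, -7 * \<beta>^2, 0, -4 * \<beta>^4, 0, -(\<beta>^6), 0, 7 * \<beta>^8, 0, -(\<beta>^10), 0,
     \<beta>^12, 0, -2 * \<beta>^14, 0, \<beta>^16, 0, -(\<beta>^18), 0, 7 * \<beta>^20, 0, -(\<beta>^22), 0,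
     -4 * \<beta>^24, 0, -7 * \<beta>^26, 0, \<beta>^28, 0, -(\<beta>^30), 0, 7 * \<beta>^32, 0,
     4 * \<beta>^34, 0, \<beta>^36, 0, -7 * \<beta>^38, 0, \<beta>^40, 0, -(\<beta>^42), 0,
     2 * \<beta>^44, 0, -(\<beta>^46), 0, \<beta>^48, 0, -7 * \<beta>^50, 0, \<beta>^52, 0,
     4 * \<beta>^54, 0, 7 * \<beta>^56, 0, -(\<beta>^58), 0]"

lemma length_a_vec: "length a_vec = 60"
  by (simp add: a_vec_def)

text \<open>The vector is indexed from 1, lists from 0; only \<open>1 \<le> j \<le> 60\<close> is meaningful.\<close>

definition a_coeff :: "nat \<Rightarrow> real"
  where "a_coeff j = a_vec ! (j - 1)"

end

theory Submission
  imports Defs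
begin

text \<open>
  Up to powers of \<open>\<beta>\<close> and the sign \<open>\<chi> j\<close> of the arctangent series, \<open>a_coeff j\<close> depends only on
  \<open>gcd j 15\<close>. Sorting the terms by divisibility by \<open>3\<close> and \<open>5\<close> turns \<open>\<beta>\<close> times the series into
  \<open>arctan \<beta> - 2 * arctan (\<beta> ^ 3) - arctan (\<beta> ^ 5)\<close>. This vanishes because
  \<open>2 * arctan (\<beta> ^ 3) = - arctan (1 / 2)\<close> and \<open>\<beta> ^ 2 = \<beta> + 1\<close>.
\<close>

text \<open>The nonprincipal Dirichlet character modulo 4, hence completely multiplicative.\<close>

definition \<chi> :: "nat \<Rightarrow> real" where
  "\<chi> n = (if even n then 0 else (- 1) ^ (n div 2))"

lemma \<chi>_mult: "\<chi> (m * n) = \<chi> m * \<chi> n"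
proof (cases "odd m \<and> odd n")
  case True
  then obtain a b where "m = 2 * a + 1" "n = 2 * b + 1"
    by (meson oddE)
  moreover have "(2 * a + 1) * (2 * b + 1) div 2 = 2 * (a * b) + (a + b)"
    by (simp add: algebra_simps)
  ultimately show ?thesis
    by (simp add: \<chi>_def power_add power_mult)
qed (auto simp: \<chi>_def)

lemma \<chi>_add_60: "\<chi> (60 * k + j) = \<chi> j"
proof -
  have "(60 * k + j) div 2 = 2 * (15 * k) + j div 2"
    by presburger
  then show ?thesis
    by (simp add: \<chi>_def power_add power_mult)
qed

text \<open>Padding the series with zeros at even \<open>n\<close> lets its terms be selected later
  by divisibility of \<open>n\<close>.\<close>

lemma arctan_sums:
  assumes "\<bar>x\<bar> \<le> 1"
  shows "(\<lambda>n. \<chi> n * x ^ n / real n) sums arctan x"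
proof -
  have "(\<lambda>k. (- 1) ^ k * (1 / real (k * 2 + 1) * x ^ (k * 2 + 1))) sums arctan x"
    using summable_arctan_series[OF assms] arctan_series[OF assms] by (simp add: summable_sums)
  moreover have "(- 1) ^ k * (1 / real (k * 2 + 1) * x ^ (k * 2 + 1)) =
      \<chi> (2 * k + 1) * x ^ (2 * k + 1) / real (2 * k + 1)" for k
    by (simp add: \<chi>_def mult.commute)
  ultimately have odd_terms: "(\<lambda>k. \<chi> (2 * k + 1) * x ^ (2 * k + 1) / real (2 * k + 1)) sums arctan x"
    by (simp only:)
  show ?thesis
  proof (rule sums_mono_reindex[where g = "\<lambda>k. 2 * k + 1", THEN iffD1, OF _ _ odd_terms])
    show "strict_mono (\<lambda>k::nat. 2 * k + 1)"
      by (simp add: strict_mono_def)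
    show "\<chi> n * x ^ n / real n = 0" if "n \<notin> range (\<lambda>k. 2 * k + 1)" for n
      using that by (auto simp: \<chi>_def elim!: oddE)
  qed
qed

text \<open>Put \<open>n = d * m\<close>: multiplicativity of \<open>\<chi>\<close> pulls out
  \<open>\<chi> d / d\<close> and leaves the arctangent series at \<open>x ^ d\<close>.\<close>

lemma arctan_power_sums:
  assumes "\<bar>x\<bar> \<le> 1" "d > 0"
  shows "(\<lambda>n. of_bool (d dvd n) * (\<chi> n * x ^ n / real n)) sums (\<chi> d / real d * arctan (x ^ d))"
proof -
  have "\<bar>x ^ d\<bar> \<le> 1"
    using assms by (simp add: power_abs power_le_one)
  then have "(\<lambda>n. \<chi> d / real d * (\<chi> n * (x ^ d) ^ n / real n)) sums (\<chi> d / real d * arctan (x ^ d))"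
    by (intro sums_mult arctan_sums)
  then have multiples: "(\<lambda>n. of_bool (d dvd d * n) * (\<chi> (d * n) * x ^ (d * n) / real (d * n)))
      sums (\<chi> d / real d * arctan (x ^ d))"
    by (simp add: \<chi>_mult power_mult mult.assoc)
  show ?thesis
  proof (rule sums_mono_reindex[where g = "\<lambda>n. d * n", THEN iffD1, OF _ _ multiples])
    show "strict_mono (\<lambda>n. d * n)"
      using assms(2) by (simp add: strict_mono_def)
    show "of_bool (d dvd n) * (\<chi> n * x ^ n / real n) = 0" if "n \<notin> range (\<lambda>n. d * n)" for n
      using that by auto
  qed
qed

lemma golden_beta_sq: "\<beta> ^ 2 = \<beta> + 1"
  by (simp add: golden_beta_def power2_eq_square field_simps)

lemma golden_beta_bounds: "- 1 < \<beta>" "\<beta> < 0"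
proof -
  have "sqrt 5 < sqrt (3 ^ 2)" "sqrt 1 < sqrt 5"
    by (subst real_sqrt_less_iff, simp)+
  then show "- 1 < \<beta>" "\<beta> < 0"
    by (simp_all add: golden_beta_def)
qed

lemma arctan_golden_beta: "arctan \<beta> = 2 * arctan (\<beta> ^ 3) + arctan (\<beta> ^ 5)"
proof -
  note bounds = golden_beta_bounds
  have p3: "\<beta> ^ 3 = 2 * \<beta> + 1" and p5: "\<beta> ^ 5 = 5 * \<beta> + 3"
    using golden_beta_sq by algebra+
  have abs_lt: "\<bar>\<beta> ^ n\<bar> < 1" if "n > 0" for n
    using bounds that by (simp add: power_abs power_Suc_less_one power_less_one_iff)
  have "\<beta> ^ 3 < 0"
    using bounds by (simp add: power3_eq_cube zero_less_mult_iff mult_less_0_iff)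
  then have ne: "1 + 2 * \<beta> \<noteq> 0"
    using p3 by simp
  \<comment> \<open>Here \<open>\<beta> ^ 6 = 8 * \<beta> + 5\<close>. As
    \<open>\<beta> ^ 3 = 2 * \<beta> + 1\<close>, the denominator equals
    \<open>- 4 * \<beta> ^ 3\<close>, so the quotient in the doubling formula collapses to
    \<open>- 1 / 2\<close>.\<close>
  have denom: "1 - (\<beta> ^ 3) ^ 2 = - 4 * (1 + 2 * \<beta>)"
    using golden_beta_sq by algebra
  have "2 * arctan (\<beta> ^ 3) = arctan (2 * \<beta> ^ 3 / (1 - (\<beta> ^ 3) ^ 2))"
    by (intro arctan_double abs_lt) simp
  also have "2 * \<beta> ^ 3 / (1 - (\<beta> ^ 3) ^ 2) = - 1 / 2"
  proof -
    have "1 - (\<beta> ^ 3) ^ 2 \<noteq> 0"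
      unfolding denom using ne by simp
    moreover have "2 * \<beta> ^ 3 = - 1 / 2 * (1 - (\<beta> ^ 3) ^ 2)"
      unfolding denom by (simp add: p3 field_simps)
    ultimately show ?thesis
      by (metis nonzero_mult_div_cancel_right)
  qed
  finally have "2 * arctan (\<beta> ^ 3) + arctan (\<beta> ^ 5) = arctan (- 1 / 2) + arctan (\<beta> ^ 5)"
    by simp
  also have "\<dots> = arctan ((- 1 / 2 + \<beta> ^ 5) / (1 - (- 1 / 2) * \<beta> ^ 5))"
    by (intro arctan_add abs_lt) simp_all
  also have "(- 1 / 2 + \<beta> ^ 5) / (1 - (- 1 / 2) * \<beta> ^ 5) = \<beta>"
  proof -
    \<comment> \<open>The left side is \<open>5 * (\<beta> + 1) / 2\<close>, which is positive
      because \<open>\<beta> > - 1\<close>.\<close>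
    have "1 - (- 1 / 2) * \<beta> ^ 5 \<noteq> 0"
      using bounds by (simp add: p5 field_simps)
    moreover have "- 1 / 2 + \<beta> ^ 5 = \<beta> * (1 - (- 1 / 2) * \<beta> ^ 5)"
      unfolding p5 using golden_beta_sq by (simp add: power2_eq_square field_simps)
    ultimately show ?thesis
      by (metis nonzero_mult_div_cancel_right)
  qed
  finally show ?thesis ..
qed

text \<open>The values are 1, 7, -4, 2 for \<open>gcd n 15\<close> equal to 1, 3, 5, 15. The
  coefficients 6 and -5 are chosen to absorb the factors \<open>\<chi> 3 / 3 = - 1 / 3\<close> and
  \<open>\<chi> 5 / 5 = 1 / 5\<close>, leaving -2 and -1.\<close>

definition weight :: "nat \<Rightarrow> real" where
  "weight n = 1 + 6 * of_bool (3 dvd n) - 5 * of_bool (5 dvd n)"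

lemma weight_add_60: "weight (60 * k + j) = weight j"
proof -
  have "3 dvd 60 * k + j \<longleftrightarrow> 3 dvd j" "5 dvd 60 * k + j \<longleftrightarrow> 5 dvd j"
    by presburger+
  then show ?thesis
    by (simp add: weight_def)
qed

text \<open>The vector carries \<open>\<beta> ^ (j - 1)\<close> at position \<open>j\<close>; the
  extra factor \<open>\<beta>\<close> aligns exponent and index, as the arctangent series
  requires.\<close>

lemma golden_beta_mult_a_coeff:
  assumes "j \<in> {1..60}"
  shows "\<beta> * a_coeff j = \<chi> j * weight j * \<beta> ^ j"
proof -
  \<comment> \<open>Splitting off 0 and 1 leaves an interval with numeral bounds, which evaluates
    explicitly; the next claim is then a comparison of all 60 entries.\<close>
  have "[0..<60] = 0 # 1 # [2..<60]"
    by (simp add: upt_conv_Cons numeral_2_eq_2)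
  then have a_vec_eq: "a_vec = map (\<lambda>i. \<chi> (Suc i) * weight (Suc i) * \<beta> ^ i) [0..<60]"
    by (simp add: a_vec_def \<chi>_def weight_def)
  obtain i where "j = Suc i" "i < 60"
    using assms by (cases j) auto
  then show ?thesis
    unfolding a_coeff_def a_vec_eq by (simp del: upt_rec_numeral)
qed

lemma weighted_sums: "(\<lambda>n. \<chi> n * weight n * \<beta> ^ n / real n) sums 0"
proof -
  have le: "\<bar>\<beta>\<bar> \<le> 1"
    using golden_beta_bounds by simp
  have "(\<lambda>n. \<chi> n * \<beta> ^ n / real n
        + 6 * (of_bool (3 dvd n) * (\<chi> n * \<beta> ^ n / real n))
        - 5 * (of_bool (5 dvd n) * (\<chi> n * \<beta> ^ n / real n)))
      sums (arctan \<beta> + 6 * (\<chi> 3 / real 3 * arctan (\<beta> ^ 3)) - 5 * (\<chi> 5 / real 5 * arctan (\<beta> ^ 5)))"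
    by (intro sums_add sums_diff sums_mult arctan_sums arctan_power_sums le) simp_all
  moreover have "\<chi> 3 = - 1" "\<chi> 5 = 1"
    by (simp_all add: \<chi>_def)
  ultimately have "(\<lambda>n. \<chi> n * \<beta> ^ n / real n
        + 6 * (of_bool (3 dvd n) * (\<chi> n * \<beta> ^ n / real n))
        - 5 * (of_bool (5 dvd n) * (\<chi> n * \<beta> ^ n / real n))) sums 0"
    by (simp add: arctan_golden_beta)
  then show ?thesis
    by (rule sums_cong[THEN iffD1, rotated]) (simp add: weight_def algebra_simps)
qed

theorem theorem4p4:
  shows "(\<lambda>k::nat. 1 / \<alpha> ^ (60 * k) * (\<Sum>j=1..60. a_coeff j / real (60 * k + j))) sums 0"
proof -
  define F where "F n = \<chi> n * weight n * \<beta> ^ n / real n" for n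
  have "F sums 0"
    unfolding F_def by (rule weighted_sums)
  \<comment> \<open>Since \<open>F 0 = 0\<close>, summation may start at 1, so that blocks of 60
    match \<open>j = 1..60\<close>.\<close>
  then have "(\<lambda>n. F (Suc n)) sums 0"
    by (subst sums_Suc_iff) (simp add: F_def)
  then have grouped: "(\<lambda>k. \<Sum>n=k*60..<k*60+60. F (Suc n)) sums 0"
    by (rule sums_group) simp
  have "(\<Sum>n=k*60..<k*60+60. F (Suc n)) =
      \<beta> * (1 / \<alpha> ^ (60 * k) * (\<Sum>j=1..60. a_coeff j / real (60 * k + j)))" for k
  proof -
    have "(\<Sum>n=k*60..<k*60+60. F (Suc n)) = (\<Sum>j=1..60. F (60 * k + j))"
      by (rule sum.reindex_bij_witness[of _ "\<lambda>j. 60 * k + j - 1" "\<lambda>n. Suc n - 60 * k"]) auto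
    also have "\<dots> = (\<Sum>j=1..60. \<beta> ^ (60 * k) * (\<beta> * (a_coeff j / real (60 * k + j))))"
    proof (rule sum.cong[OF refl])
      fix j :: nat
      assume j: "j \<in> {1..60}"
      have "F (60 * k + j) = \<beta> ^ (60 * k) * (\<chi> j * weight j * \<beta> ^ j) / real (60 * k + j)"
        by (simp add: F_def \<chi>_add_60 weight_add_60 power_add)
      then show "F (60 * k + j) = \<beta> ^ (60 * k) * (\<beta> * (a_coeff j / real (60 * k + j)))"
        by (simp flip: golden_beta_mult_a_coeff[OF j])
    qed
    \<comment> \<open>The sign in \<open>\<beta> = - 1 / \<alpha>\<close> disappears because the
      exponent is even.\<close>
    also have "\<beta> ^ (60 * k) = 1 / \<alpha> ^ (60 * k)"
      by (simp add: golden_beta_eq power_divide power_mult)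
    finally show ?thesis
      by (simp add: sum_distrib_left mult_ac)
  qed
  with grouped have "(\<lambda>k. \<beta> * (1 / \<alpha> ^ (60 * k) * (\<Sum>j=1..60. a_coeff j / real (60 * k + j)))) sums (\<beta> * 0)"
    by simp
  \<comment> \<open>The factor \<open>\<beta>\<close> cancels because it is nonzero.\<close>
  then show ?thesis
    using golden_beta_bounds by (subst (asm) sums_mult_iff) simp_all
qed

end
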